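(* Let $f:\mathbb{R}^n\to\mathbb{R}\cup\{+\infty\}$ be proper, lower semicontinuous and convex, $A\in\mathbb{R}^{m\times n}$, $b\in\mathbb{R}^m$, and let $X$ be the set of minimizers over $x\in\mathbb{R}^n$ of $f(x)+\frac12\|Ax-b\|^2$. Assume $X\neq\varnothing$ and let $r=b-Ax^\star$ for $x^\star\in X$. Then $X$ is compact (i) if and only if $\big(\partial f^*(A^\top r)\big)_\infty\cap\ker A=\{0\}$; (ii) if $\big(\mathcal P_{\ker A}(\partial f^*(A^\top r))\big)_\infty=\{0\}$.
   Context: $f^*$ is the convex conjugate and $\partial$ the convex subdifferential. $\mathcal P_{\ker A}$ is the orthogonal projection onto $\ker A$, applied elementwise to sets. For a nonempty convex set $C$, $C_\infty=\{d: x+td\in C\ \ \forall x\in C,\ \forall t>0\}$ is its recession cone. The vector $Ax^\star$, hence $r$, is the same for all $x^\star\in X$. *)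

theory Defs
  imports "HOL-Analysis.Analysis"
begin

definition proper_fun :: "('a \<Rightarrow> ereal) \<Rightarrow> bool" where
  "proper_fun f \<longleftrightarrow> (\<forall>x. f x \<noteq> -\<infinity>) \<and> (\<exists>x. f x \<noteq> \<infinity>)"

definition lsc_fun :: "('a::topological_space \<Rightarrow> ereal) \<Rightarrow> bool" where
  "lsc_fun f \<longleftrightarrow> (\<forall>x. f x \<le> Liminf (at x) f)"

text \<open>Intended for functions that never take the value \<open>-\<infinity>\<close> (in particular proper ones), so that no
  sum of opposite infinities occurs; note that \<open>0 * \<infinity> = 0\<close> in \<^typ>\<open>ereal\<close>.\<close>
definition convex_fun :: "('a::real_vector \<Rightarrow> ereal) \<Rightarrow> bool" where
  "convex_fun f \<longleftrightarrow>
     (\<forall>x y t. 0 \<le> t \<longrightarrow> t \<le> 1 \<longrightarrow>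
        f ((1 - t) *\<^sub>R x + t *\<^sub>R y) \<le> ereal (1 - t) * f x + ereal t * f y)"

definition convex_conjugate :: "('a::real_inner \<Rightarrow> ereal) \<Rightarrow> 'a \<Rightarrow> ereal" where
  "convex_conjugate f y = (SUP x. ereal (y \<bullet> x) - f x)"

text \<open>If \<open>g\<close> is proper, then \<open>subdifferential g y\<close> is empty wherever \<open>g y = \<infinity>\<close>, as usual.\<close>
definition subdifferential :: "('a::real_inner \<Rightarrow> ereal) \<Rightarrow> 'a \<Rightarrow> 'a set" where
  "subdifferential g y = {v. \<forall>z. g y + ereal (v \<bullet> (z - y)) \<le> g z}"

definition recession_cone :: "'a::real_vector set \<Rightarrow> 'a set" where
  "recession_cone C = {d. \<forall>x\<in>C. \<forall>t>0. x + t *\<^sub>R d \<in> C}"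

definition mat_ker :: "real^'n^'m \<Rightarrow> (real^'n) set" where
  "mat_ker A = {x. A *v x = 0}"

definition orth_proj :: "'a::euclidean_space set \<Rightarrow> 'a \<Rightarrow> 'a" where
  "orth_proj S x = (THE p. p \<in> S \<and> (\<forall>s\<in>S. orthogonal (x - p) s))"

lemma orth_proj_eqI:
  assumes "subspace S" "p \<in> S" "\<And>s. s \<in> S \<Longrightarrow> orthogonal (x - p) s"
  shows "orth_proj S x = p"
  unfolding orth_proj_def
proof (rule the_equality)
  show "p \<in> S \<and> (\<forall>s\<in>S. orthogonal (x - p) s)" using assms by auto
  fix q assume q: "q \<in> S \<and> (\<forall>s\<in>S. orthogonal (x - q) s)"
  have "q - p \<in> S" using assms q by (auto intro: subspace_diff)
  then have "(x - p) \<bullet> (q - p) = 0" "(x - q) \<bullet> (q - p) = 0"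
    using assms(3) q by (auto simp: orthogonal_def)
  then have "(q - p) \<bullet> (q - p) = 0"
    by (simp add: inner_diff_left)
  then show "q = p" by simp
qed

lemma orth_proj:
  assumes "subspace S"
  shows "orth_proj S x \<in> S" and "s \<in> S \<Longrightarrow> orthogonal (x - orth_proj S x) s"
proof -
  obtain y z where "y \<in> span S" "\<And>w. w \<in> span S \<Longrightarrow> orthogonal z w" "x = y + z"
    using orthogonal_subspace_decomp_exists [of S x] by metis
  then have y: "y \<in> S" "\<And>s. s \<in> S \<Longrightarrow> orthogonal (x - y) s"
    using assms by (auto simp: span_base span_eq_iff [THEN iffD2])
  then have "orth_proj S x = y" by (intro orth_proj_eqI assms)
  with y show "orth_proj S x \<in> S" "s \<in> S \<Longrightarrow> orthogonal (x - orth_proj S x) s" by auto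
qed

lemma subspace_mat_ker: "subspace (mat_ker A)"
  by (auto simp: mat_ker_def subspace_def matrix_vector_right_distrib matrix_vector_mult_scaleR)

definition ls_objective :: "(real^'n \<Rightarrow> ereal) \<Rightarrow> real^'n^'m \<Rightarrow> real^'m \<Rightarrow> real^'n \<Rightarrow> ereal" where
  "ls_objective f A b x = f x + ereal (1 / 2 * (norm (A *v x - b))\<^sup>2)"

definition minimizers :: "('a \<Rightarrow> ereal) \<Rightarrow> 'a set" where
  "minimizers F = {x. \<forall>y. F x \<le> F y}"

end

theory Submission
  imports Defs
begin

text \<open>
  Write \<open>g = A\<^sup>T r\<close>. First-order optimality of \<open>xs\<close> says that the affine function
  \<open>x \<mapsto> f xs + g \<bullet> (x - xs)\<close> minorizes \<open>f\<close>. Let \<open>M\<close> be the set of points at which this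
  minorant is attained; since \<open>f\<close> is lower semicontinuous and convex, \<open>M\<close> is closed and convex.
  Two identifications reduce the theorem to convex geometry.

  \<^item> \<open>M = \<partial>f\<^sup>*(g)\<close>. The inclusion from right to left is the Fenchel-Moreau argument: over a
    point outside \<open>M\<close>, the graph of the minorant lies strictly below the closed convex epigraph of
    \<open>f\<close>; separating the two gives a second affine minorant of \<open>f\<close> that is larger at this point, and
    its slope violates the subgradient inequality for \<open>f\<^sup>*\<close>
    (lemmas \<open>exists_affine_minorant_above\<close> and \<open>subdifferential_conjugate_eq_contact_set\<close>).

  \<^item> \<open>X = M \<inter> {x. A x = A xs}\<close>. The excess of the objective at \<open>x\<close> over its minimum is the gap
    between \<open>f\<close> and its minorant plus \<open>|A (x - xs)|\<^sup>2 / 2\<close>, a sum of two nonnegative terms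
    (lemma \<open>minimizers_ls_objective_eq\<close>).

  An unbounded set has a nonzero limit direction, along which every closed convex superset
  recedes (lemma \<open>unbounded_imp_common_recession_direction\<close>). Applied to \<open>X\<close>
  and its supersets \<open>M\<close> and \<open>{x. A x = A xs}\<close>, whose recession cone is \<open>ker A\<close>, this shows that
  an unbounded \<open>X\<close> forces a nonzero vector in \<open>M\<^sub>\<infinity> \<inter> ker A\<close>; conversely such a vector spans a ray
  inside \<open>X\<close>. For the second part, the projection fixes \<open>ker A\<close>, so such a vector is also a
  recession direction of the projected set.
\<close>

section \<open>Epigraphs and affine minorants\<close>

definition epi :: "('a \<Rightarrow> ereal) \<Rightarrow> ('a \<times> real) set" where
  "epi f = {(x, t). f x \<le> ereal t}"

lemma closed_epi:
  fixes f :: "'a::topological_space \<Rightarrow> ereal"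
  assumes "lsc_fun f"
  shows "closed (epi f)"
  unfolding closed_def
proof (subst open_subopen, intro ballI)
  fix q assume "q \<in> - epi f"
  then obtain x t where q: "q = (x, t)" and "ereal t < f x"
    by (cases q) (auto simp: epi_def)
  then obtain s where s: "ereal t < ereal s" "ereal s < f x"
    using ereal_dense2 by blast
  have "eventually (\<lambda>y. ereal s < f y) (at x)"
    using assms s(2) unfolding lsc_fun_def le_Liminf_iff by blast
  then obtain U where U: "open U" "x \<in> U" "\<And>y. y \<in> U \<Longrightarrow> y \<noteq> x \<Longrightarrow> ereal s < f y"
    by (auto simp: eventually_at_topological)
  have *: "ereal s < f y" if "y \<in> U" for y
    using U(3)[OF that] s(2) by (cases "y = x") auto
  have "U \<times> {..<s} \<subseteq> - epi f"
  proof clarsimp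
    fix y u assume "y \<in> U" "u < s" "(y, u) \<in> epi f"
    then have "f y \<le> ereal u" by (simp add: epi_def)
    with *[OF \<open>y \<in> U\<close>] have "ereal s < ereal u" by (rule less_le_trans)
    with \<open>u < s\<close> show False by simp
  qed
  moreover have "open (U \<times> {..<s})" "q \<in> U \<times> {..<s}"
    using U s q by (auto intro: open_Times)
  ultimately show "\<exists>T. open T \<and> q \<in> T \<and> T \<subseteq> - epi f" by blast
qed

lemma convex_epi:
  assumes "convex_fun f"
  shows "convex (epi f)"
  unfolding convex_alt
proof (clarsimp simp: epi_def)
  fix x y and a b t :: real
  assume le: "f x \<le> ereal a" "f y \<le> ereal b" and t: "0 \<le> t" "t \<le> 1"
  have "f ((1 - t) *\<^sub>R x + t *\<^sub>R y) \<le> ereal (1 - t) * f x + ereal t * f y"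
    using assms t by (auto simp: convex_fun_def)
  also have "\<dots> \<le> ereal (1 - t) * ereal a + ereal t * ereal b"
    using le t by (intro add_mono ereal_mult_left_mono) auto
  finally show "f ((1 - t) *\<^sub>R x + t *\<^sub>R y) \<le> ereal ((1 - t) * a + t * b)" by simp
qed

text \<open>
  The heart of the Fenchel-Moreau theorem. The point \<open>(x0, a)\<close> lies strictly below the epigraph
  and is separated from it by a hyperplane. A hyperplane that is not vertical is the graph of the
  required minorant; a vertical one only gives an affine function negative on the domain of
  \<open>f\<close> and positive at \<open>x0\<close>, a large multiple of which is added to the given minorant.
\<close>
lemma exists_affine_minorant_above:
  fixes f :: "'a::euclidean_space \<Rightarrow> ereal"
  assumes "proper_fun f" "lsc_fun f" "convex_fun f"
    and minorant: "\<And>x. ereal (g \<bullet> x - c) \<le> f x"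
    and a: "ereal a < f x0"
  shows "\<exists>z \<gamma>. (\<forall>x. ereal (z \<bullet> x - \<gamma>) \<le> f x) \<and> a < z \<bullet> x0 - \<gamma>"
proof -
  have "(x0, a) \<notin> epi f" using a by (auto simp: epi_def)
  then obtain q \<beta> where "q \<bullet> (x0, a) < \<beta>" "\<And>w. w \<in> epi f \<Longrightarrow> q \<bullet> w > \<beta>"
    using separating_hyperplane_closed_point[OF convex_epi closed_epi] assms by metis
  moreover obtain p s where "q = (p, s)" by (cases q)
  ultimately have below: "p \<bullet> x0 + s * a < \<beta>"
    and above: "\<And>x t. f x \<le> ereal t \<Longrightarrow> p \<bullet> x + s * t > \<beta>"
    by (auto simp: epi_def inner_prod_def)
  have finite_or_top: "(\<exists>t. f x = ereal t) \<or> f x = \<infinity>" for x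
    using minorant[of x] by (cases "f x") auto
  obtain x1 t1 where x1: "f x1 = ereal t1"
    using assms(1) finite_or_top unfolding proper_fun_def by metis
  have "s \<ge> 0"
  proof (rule ccontr)
    assume "\<not> s \<ge> 0"
    then have s: "s < 0" by simp
    define t where "t = max t1 ((\<beta> - p \<bullet> x1) / s)"
    have "p \<bullet> x1 + s * t > \<beta>" by (intro above) (simp add: x1 t_def)
    moreover have "s * t \<le> s * ((\<beta> - p \<bullet> x1) / s)"
      using s by (intro mult_left_mono_neg) (auto simp: t_def)
    ultimately show False using s by simp
  qed
  then consider "s > 0" | "s = 0" by linarith
  then show ?thesis
  proof cases
    case 1
    have "ereal ((- (1 / s) *\<^sub>R p) \<bullet> x - (- \<beta> / s)) \<le> f x" for x
      using finite_or_top[of x]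
    proof
      assume "\<exists>t. f x = ereal t"
      then obtain t where t: "f x = ereal t" by blast
      with above[of x t] 1 show ?thesis by (simp add: field_simps)
    qed simp
    moreover have "a < (- (1 / s) *\<^sub>R p) \<bullet> x0 - (- \<beta> / s)"
      using below 1 by (simp add: field_simps)
    ultimately show ?thesis by blast
  next
    case 2
    define e where "e = \<beta> - p \<bullet> x0"
    have e: "e > 0" using below 2 by (simp add: e_def)
    define k where "k = (\<bar>a - g \<bullet> x0 + c\<bar> + 1) / e"
    have k: "k \<ge> 0" "k * e = \<bar>a - g \<bullet> x0 + c\<bar> + 1" using e by (auto simp: k_def)
    have "ereal ((g - k *\<^sub>R p) \<bullet> x - (c - k * \<beta>)) \<le> f x" for x
      using finite_or_top[of x]
    proof
      assume "\<exists>t. f x = ereal t"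
      then obtain t where t: "f x = ereal t" by blast
      have "k * \<beta> \<le> k * (p \<bullet> x)"
        using above[of x t] t 2 k(1) by (intro mult_left_mono) auto
      moreover have "g \<bullet> x - c \<le> t" using minorant[of x] t by simp
      ultimately show ?thesis using t by (simp add: inner_diff_left)
    qed simp
    moreover have "a < (g - k *\<^sub>R p) \<bullet> x0 - (c - k * \<beta>)"
      using k(2) by (simp add: e_def inner_diff_left algebra_simps)
    ultimately show ?thesis by blast
  qed
qed

lemma convex_conjugate_le_iff:
  assumes "\<And>x. f x \<noteq> -\<infinity>"
  shows "convex_conjugate f z \<le> ereal \<gamma> \<longleftrightarrow> (\<forall>x. ereal (z \<bullet> x - \<gamma>) \<le> f x)"
proof -
  have "ereal (z \<bullet> x) - f x \<le> ereal \<gamma> \<longleftrightarrow> ereal (z \<bullet> x - \<gamma>) \<le> f x" for x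
    using assms[of x] by (cases "f x") auto
  then show ?thesis by (simp add: convex_conjugate_def SUP_le_iff)
qed

text \<open>
  The subdifferential of the conjugate inverts that of \<open>f\<close>: its points are those where the
  supporting affine function of slope \<open>g\<close> is attained. That supporting function
  exists by assumption, being attained at \<open>x0\<close>.
\<close>
lemma subdifferential_conjugate_eq_contact_set:
  fixes f :: "'a::euclidean_space \<Rightarrow> ereal"
  assumes f: "proper_fun f" "lsc_fun f" "convex_fun f"
    and "f x0 = ereal v" and minorant: "\<And>x. ereal (v + g \<bullet> (x - x0)) \<le> f x"
  shows "subdifferential (convex_conjugate f) g = {x. f x \<le> ereal (v + g \<bullet> (x - x0))}"
proof -
  define c where "c = g \<bullet> x0 - v"
  have fin: "f x \<noteq> -\<infinity>" for x using f(1) by (simp add: proper_fun_def)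
  have min': "ereal (g \<bullet> x - c) \<le> f x" for x
    using minorant[of x] by (simp add: c_def inner_diff_right algebra_simps)
  have "ereal (g \<bullet> x0) - f x0 \<le> convex_conjugate f g"
    unfolding convex_conjugate_def by (rule SUP_upper) simp
  then have conj: "convex_conjugate f g = ereal c"
    using min' assms(4) by (intro antisym) (simp_all add: convex_conjugate_le_iff[OF fin] c_def)
  have "x \<in> subdifferential (convex_conjugate f) g \<longleftrightarrow> f x \<le> ereal (g \<bullet> x - c)" for x
  proof
    assume sub: "x \<in> subdifferential (convex_conjugate f) g"
    show "f x \<le> ereal (g \<bullet> x - c)"
    proof (rule ccontr)
      assume "\<not> ?thesis"
      then have "ereal (g \<bullet> x - c) < f x" by simp
      from exists_affine_minorant_above[OF f min' this]
      obtain z \<gamma> where z: "\<forall>y. ereal (z \<bullet> y - \<gamma>) \<le> f y" "g \<bullet> x - c < z \<bullet> x - \<gamma>" by blast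
      have "ereal (c + x \<bullet> (z - g)) \<le> convex_conjugate f z"
        using sub conj by (simp add: subdifferential_def)
      also have "\<dots> \<le> ereal \<gamma>" using z(1) by (simp add: convex_conjugate_le_iff[OF fin])
      finally show False using z(2) by (simp add: inner_diff_right inner_commute)
    qed
  next
    assume le: "f x \<le> ereal (g \<bullet> x - c)"
    then obtain t where t: "f x = ereal t" using fin[of x] by (cases "f x") auto
    have "ereal (c + x \<bullet> (z - g)) \<le> convex_conjugate f z" for z
    proof -
      have "ereal (c + x \<bullet> (z - g)) \<le> ereal (z \<bullet> x) - f x"
        using le t by (simp add: inner_diff_right inner_commute)
      also have "\<dots> \<le> convex_conjugate f z"
        unfolding convex_conjugate_def by (rule SUP_upper) simp
      finally show ?thesis .
    qed
    then show "x \<in> subdifferential (convex_conjugate f) g"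
      by (simp add: subdifferential_def conj)
  qed
  then show ?thesis by (auto simp: c_def inner_diff_right algebra_simps)
qed

lemma closed_convex_contact_set:
  fixes f :: "'a::real_inner \<Rightarrow> ereal"
  assumes "lsc_fun f" "convex_fun f"
  shows "closed {x. f x \<le> ereal (v + g \<bullet> (x - x0))}"
    and "convex {x. f x \<le> ereal (v + g \<bullet> (x - x0))}"
proof -
  define h where "h x = (x, v + g \<bullet> (x - x0))" for x
  have eq: "{x. f x \<le> ereal (v + g \<bullet> (x - x0))} = h -` epi f"
    by (auto simp: h_def epi_def)
  have "continuous_on UNIV h" unfolding h_def by (intro continuous_intros)
  then show "closed {x. f x \<le> ereal (v + g \<bullet> (x - x0))}"
    unfolding eq using closed_epi[OF assms(1)] by (intro closed_vimage)
  have aff: "h ((1 - u) *\<^sub>R x + u *\<^sub>R y) = (1 - u) *\<^sub>R h x + u *\<^sub>R h y" for x y u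
    by (simp add: h_def inner_diff_right inner_add_right algebra_simps)
  show "convex {x. f x \<le> ereal (v + g \<bullet> (x - x0))}"
    unfolding eq using convex_epi[OF assms(2)] by (auto simp: convex_alt aff)
qed

section \<open>The minimizers of the regularized least-squares problem\<close>

lemma ls_objective_expansion:
  fixes A :: "real^'n^'m"
  shows "1 / 2 * (norm (A *v y - b))\<^sup>2 = 1 / 2 * (norm (A *v x - b))\<^sup>2
    - (transpose A *v (b - A *v x)) \<bullet> (y - x) + 1 / 2 * (norm (A *v (y - x)))\<^sup>2"
proof -
  have "A *v y - b = (A *v x - b) + A *v (y - x)"
    by (simp add: matrix_vector_mult_diff_distrib)
  then have "(norm (A *v y - b))\<^sup>2 = (norm (A *v x - b))\<^sup>2
      + 2 * ((A *v x - b) \<bullet> (A *v (y - x))) + (norm (A *v (y - x)))\<^sup>2"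
    by (simp only: power2_norm_eq_inner inner_add_left inner_add_right inner_commute)
  moreover have "(transpose A *v (b - A *v x)) \<bullet> (y - x) = - ((A *v x - b) \<bullet> (A *v (y - x)))"
    by (simp add: dot_lmul_matrix flip: vector_transpose_matrix) (simp add: inner_diff_left)
  ultimately show ?thesis by (simp add: field_simps)
qed

lemma minimizer_ls_objective_finite:
  assumes "proper_fun f" "xs \<in> minimizers (ls_objective f A b)"
  obtains v where "f xs = ereal v"
proof -
  obtain y where y: "f y \<noteq> \<infinity>" "f y \<noteq> -\<infinity>" "f xs \<noteq> -\<infinity>"
    using assms(1) by (auto simp: proper_fun_def)
  have "ls_objective f A b xs \<le> ls_objective f A b y"
    using assms(2) by (simp add: minimizers_def)
  then show thesis
    using y that unfolding ls_objective_def by (cases "f xs"; cases "f y") auto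
qed

text \<open>
  Moving from \<open>xs\<close> a fraction \<open>t\<close> of the way to \<open>x\<close>, the quadratic term changes by its linearization
  plus \<open>O(t\<^sup>2)\<close>, while \<open>f\<close> grows at most by \<open>t * (f x - f xs)\<close>. Dividing by \<open>t\<close> and letting it
  tend to \<open>0\<close> leaves the subgradient inequality.
\<close>
lemma minimizer_ls_objective_subgradient:
  fixes A :: "real^'n^'m"
  assumes f: "proper_fun f" "convex_fun f" and min: "xs \<in> minimizers (ls_objective f A b)"
    and v: "f xs = ereal v"
  shows "ereal (v + (transpose A *v (b - A *v xs)) \<bullet> (x - xs)) \<le> f x"
proof (cases "f x")
  case (real w)
  define g where "g = transpose A *v (b - A *v xs)"
  define q where "q = 1 / 2 * (norm (A *v (x - xs)))\<^sup>2"
  have step: "v + g \<bullet> (x - xs) \<le> w + t * q" if t: "0 < t" "t < 1" for t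
  proof -
    define y where "y = (1 - t) *\<^sub>R xs + t *\<^sub>R x"
    have dy: "y - xs = t *\<^sub>R (x - xs)" by (simp add: y_def algebra_simps)
    have "f y \<le> ereal (1 - t) * f xs + ereal t * f x"
      using f(2) t unfolding convex_fun_def y_def by auto
    then have fy: "f y \<le> ereal ((1 - t) * v + t * w)" by (simp add: v real)
    then obtain u where u: "f y = ereal u"
      using f(1) by (cases "f y") (auto simp: proper_fun_def)
    have "ls_objective f A b xs \<le> ls_objective f A b y"
      using min by (simp add: minimizers_def)
    then have "v + 1 / 2 * (norm (A *v xs - b))\<^sup>2 \<le> u + 1 / 2 * (norm (A *v y - b))\<^sup>2"
      by (simp add: ls_objective_def v u)
    moreover have "u \<le> (1 - t) * v + t * w" using fy u by simp
    moreover have "1 / 2 * (norm (A *v y - b))\<^sup>2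
        = 1 / 2 * (norm (A *v xs - b))\<^sup>2 - t * (g \<bullet> (x - xs)) + t * (t * q)"
      unfolding ls_objective_expansion[of A y b xs] dy
      by (simp add: g_def q_def matrix_vector_mult_scaleR power_mult_distrib power2_eq_square)
    ultimately have "t * (v + g \<bullet> (x - xs)) \<le> t * (w + t * q)"
      by (simp add: algebra_simps)
    then show ?thesis using t by simp
  qed
  have "((\<lambda>t. w + t * q) \<longlongrightarrow> w + 0 * q) (at_right 0)"
    by (intro tendsto_intros)
  moreover have "eventually (\<lambda>t. v + g \<bullet> (x - xs) \<le> w + t * q) (at_right 0)"
    unfolding eventually_at_right_field using step by (intro exI[of _ 1]) auto
  ultimately have "v + g \<bullet> (x - xs) \<le> w + 0 * q"
    by (intro tendsto_lowerbound) auto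
  then show ?thesis by (simp add: real g_def)
qed (use f in \<open>auto simp: proper_fun_def\<close>)

lemma minimizers_ls_objective_eq:
  fixes A :: "real^'n^'m"
  assumes f: "proper_fun f" "convex_fun f" and min: "xs \<in> minimizers (ls_objective f A b)"
    and v: "f xs = ereal v"
  shows "minimizers (ls_objective f A b)
    = {x. f x \<le> ereal (v + (transpose A *v (b - A *v xs)) \<bullet> (x - xs))} \<inter> {x. A *v x = A *v xs}"
proof -
  define g where "g = transpose A *v (b - A *v xs)"
  define n where "n = 1 / 2 * (norm (A *v xs - b))\<^sup>2"
  have minorant: "ereal (v + g \<bullet> (x - xs)) \<le> f x" for x
    unfolding g_def by (rule minimizer_ls_objective_subgradient[OF f min v])
  have obj: "ls_objective f A b x
      = f x + ereal (n - g \<bullet> (x - xs) + 1 / 2 * (norm (A *v (x - xs)))\<^sup>2)" for x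
    unfolding ls_objective_def ls_objective_expansion[of A x b xs] by (simp add: g_def n_def)
  have obj_xs: "ls_objective f A b xs = ereal (v + n)" by (simp add: obj v)
  have "x \<in> minimizers (ls_objective f A b) \<longleftrightarrow> ls_objective f A b x \<le> ereal (v + n)" for x
    using min unfolding minimizers_def obj_xs[symmetric] by (auto intro: order_trans)
  moreover have "ls_objective f A b x \<le> ereal (v + n) \<longleftrightarrow>
      f x \<le> ereal (v + g \<bullet> (x - xs)) \<and> A *v x = A *v xs" for x
  proof (cases "f x")
    case (real w)
    define q where "q = (norm (A *v (x - xs)))\<^sup>2"
    have q: "0 \<le> q" "q = 0 \<longleftrightarrow> A *v x = A *v xs"
      by (auto simp: q_def matrix_vector_mult_diff_distrib)
    have "ls_objective f A b x \<le> ereal (v + n) \<longleftrightarrow> (w - (v + g \<bullet> (x - xs))) + 1 / 2 * q \<le> 0"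
      by (simp add: obj real q_def algebra_simps)
    moreover have "v + g \<bullet> (x - xs) \<le> w" using minorant[of x] real by simp
    ultimately have "ls_objective f A b x \<le> ereal (v + n) \<longleftrightarrow> w \<le> v + g \<bullet> (x - xs) \<and> q = 0"
      using q(1) by auto
    with q(2) show ?thesis by (simp add: real)
  qed (use f in \<open>auto simp: proper_fun_def obj\<close>)
  ultimately show ?thesis by (auto simp: g_def)
qed

section \<open>Recession directions of unbounded convex sets\<close>

text \<open>
  Points \<open>X k\<close> of \<open>C\<close> with norms tending to infinity have normalizations with a limit direction
  \<open>d\<close>. For \<open>x\<close> in a closed convex \<open>D\<close> containing \<open>C\<close>, the point at parameter \<open>t / norm (X k)\<close> of the
  segment from \<open>x\<close> to \<open>X k\<close> lies in \<open>D\<close> and tends to \<open>x + t d\<close>. As \<open>d\<close> depends on \<open>C\<close> only, it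
  serves all sets \<open>D\<close> simultaneously.
\<close>
lemma unbounded_imp_common_recession_direction:
  fixes C :: "'a::euclidean_space set"
  assumes "\<not> bounded C"
  obtains d where "d \<noteq> 0"
    "\<And>D. C \<subseteq> D \<Longrightarrow> closed D \<Longrightarrow> convex D \<Longrightarrow> d \<in> recession_cone D"
proof -
  have "\<exists>x\<in>C. real (Suc k) < norm x" for k
    using assms unfolding bounded_iff by (meson linorder_not_le)
  then obtain X where XC: "\<And>k. X k \<in> C" and X: "\<And>k. real (Suc k) < norm (X k)"
    by metis
  have pos: "norm (X k) > 0" for k using X[of k] by linarith
  have "seq_compact (sphere (0::'a) 1)" by (simp add: compact_imp_seq_compact)
  moreover have "\<forall>k. X k /\<^sub>R norm (X k) \<in> sphere 0 1" using pos by (auto simp: less_imp_neq[symmetric])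
  ultimately obtain d \<sigma> where d: "d \<in> sphere 0 1" and \<sigma>: "strict_mono \<sigma>"
    and lim: "((\<lambda>k. X k /\<^sub>R norm (X k)) \<circ> \<sigma>) \<longlonglongrightarrow> d"
    by (rule seq_compactE)
  define Y where "Y k = X (\<sigma> k)" for k
  have limY: "(\<lambda>k. Y k /\<^sub>R norm (Y k)) \<longlonglongrightarrow> d" using lim by (simp add: o_def Y_def)
  have Ybig: "real k \<le> norm (Y k)" for k
    using X[of "\<sigma> k"] seq_suble[OF \<sigma>, of k] by (simp add: Y_def)
  have "filterlim (\<lambda>k. norm (Y k)) at_top sequentially"
    by (rule filterlim_at_top_mono[OF filterlim_real_sequentially]) (simp add: Ybig)
  then have inv: "(\<lambda>k. inverse (norm (Y k))) \<longlonglongrightarrow> 0"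
    by (rule tendsto_inverse_0_at_top)
  show thesis
  proof
    show "d \<noteq> 0" using d by auto
    fix D assume D: "C \<subseteq> D" "closed D" "convex D"
    show "d \<in> recession_cone D"
      unfolding recession_cone_def
    proof (intro CollectI ballI allI impI)
      fix x and t :: real assume x: "x \<in> D" and t: "t > 0"
      define Z where "Z k = (1 - t * inverse (norm (Y k))) *\<^sub>R x + t *\<^sub>R (Y k /\<^sub>R norm (Y k))" for k
      have "Z \<longlonglongrightarrow> (1 - t * 0) *\<^sub>R x + t *\<^sub>R d"
        unfolding Z_def by (intro tendsto_intros inv limY)
      then have "Z \<longlonglongrightarrow> x + t *\<^sub>R d" by simp
      moreover have "eventually (\<lambda>k. Z k \<in> D) sequentially"
      proof -
        have "eventually (\<lambda>k. real k \<ge> t) sequentially"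
          using filterlim_real_sequentially by (simp add: filterlim_at_top)
        then show ?thesis
        proof eventually_elim
          case (elim k)
          then have "t * inverse (norm (Y k)) \<le> 1"
            using Ybig[of k] t by (simp add: field_simps divide_le_eq)
          moreover have "Y k \<in> D" using XC D(1) by (auto simp: Y_def)
          ultimately show "Z k \<in> D"
            using convexD_alt[OF D(3) x, of "Y k" "t * inverse (norm (Y k))"] t by (simp add: Z_def)
        qed
      qed
      ultimately show "x + t *\<^sub>R d \<in> D"
        using D(2) by (intro Lim_in_closed_set[of D Z]) auto
    qed
  qed
qed

lemma bounded_imp_recession_direction_zero:
  assumes "bounded C" "x \<in> C" "\<And>t. t > 0 \<Longrightarrow> x + t *\<^sub>R d \<in> C"
  shows "d = (0::'a::real_normed_vector)"
proof (rule ccontr)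
  assume "d \<noteq> 0"
  obtain B where B: "\<And>y. y \<in> C \<Longrightarrow> norm y \<le> B" using assms(1) by (auto simp: bounded_iff)
  define t where "t = (2 * B + 1) / norm d"
  have "0 \<le> B" using B[OF assms(2)] norm_ge_zero[of x] by linarith
  then have t: "t > 0" using \<open>d \<noteq> 0\<close> by (simp add: t_def)
  have "2 * B + 1 = norm (t *\<^sub>R d)" using \<open>0 \<le> B\<close> \<open>d \<noteq> 0\<close> by (simp add: t_def)
  also have "\<dots> \<le> norm (x + t *\<^sub>R d) + norm x"
    using norm_triangle_ineq4[of "x + t *\<^sub>R d" x] by simp
  also have "\<dots> \<le> B + B" using B assms(2,3) t by (intro add_mono) auto
  finally show False by simp
qed

lemma orth_proj_add_subspace:
  assumes "subspace S" "d \<in> S"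
  shows "orth_proj S (x + d) = orth_proj S x + d"
  using assms orth_proj[OF assms(1)]
  by (intro orth_proj_eqI) (auto intro: subspace_add)

lemma recession_cone_orth_proj_image:
  assumes "subspace S" "d \<in> recession_cone C" "d \<in> S"
  shows "d \<in> recession_cone (orth_proj S ` C)"
  unfolding recession_cone_def
proof (intro CollectI ballI allI impI)
  fix p and t :: real assume "p \<in> orth_proj S ` C" and t: "t > 0"
  then obtain x where x: "x \<in> C" "p = orth_proj S x" by blast
  have "p + t *\<^sub>R d = orth_proj S (x + t *\<^sub>R d)"
    using assms x by (simp add: orth_proj_add_subspace subspace_scale)
  moreover have "x + t *\<^sub>R d \<in> C" using assms(2) x(1) t by (simp add: recession_cone_def)
  ultimately show "p + t *\<^sub>R d \<in> orth_proj S ` C" by blast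
qed

lemma recession_cone_fibre:
  fixes A :: "real^'n^'m"
  shows "recession_cone {x. A *v x = A *v xs} = mat_ker A"
  by (force simp: recession_cone_def mat_ker_def matrix_vector_right_distrib
      matrix_vector_mult_scaleR intro: exI[of _ "1::real"])

section \<open>Compactness of the solution set\<close>

theorem proposition2p8:
  fixes f :: "real^'n \<Rightarrow> ereal" and A :: "real^'n^'m" and b r :: "real^'m"
    and X :: "(real^'n) set" and xs :: "real^'n"
  assumes "proper_fun f" and "lsc_fun f" and "convex_fun f"
    and "X = minimizers (ls_objective f A b)"
    and "xs \<in> X" and "r = b - A *v xs"
  shows "(compact X \<longleftrightarrow>
            recession_cone (subdifferential (convex_conjugate f) (transpose A *v r)) \<inter> mat_ker A = {0})
       \<and> (recession_cone (orth_proj (mat_ker A) ` subdifferential (convex_conjugate f) (transpose A *v r)) = {0}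
            \<longrightarrow> compact X)"
proof -
  have min: "xs \<in> minimizers (ls_objective f A b)" using assms by simp
  obtain v where v: "f xs = ereal v"
    using minimizer_ls_objective_finite[OF assms(1) min] .
  define M where "M = subdifferential (convex_conjugate f) (transpose A *v r)"
  define F where "F = {x. A *v x = A *v xs}"
  have M: "M = {x. f x \<le> ereal (v + (transpose A *v r) \<bullet> (x - xs))}"
    unfolding M_def assms(6)
    by (intro subdifferential_conjugate_eq_contact_set
        minimizer_ls_objective_subgradient assms v min)
  have closed_convex_M: "closed M" "convex M"
    unfolding M using closed_convex_contact_set assms by blast+
  have X: "X = M \<inter> F"
    unfolding M F_def assms(4,6) by (rule minimizers_ls_objective_eq[OF assms(1,3) min v])
  have "closed F"
    unfolding F_def by (intro closed_Collect_eq continuous_intros)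
  moreover have "convex F"
    by (auto simp: F_def convex_alt matrix_vector_right_distrib matrix_vector_mult_scaleR
        simp flip: scaleR_add_left)
  ultimately have closed_convex: "closed M" "convex M" "closed F" "convex F"
    using closed_convex_M by auto
  have recF: "recession_cone F = mat_ker A"
    unfolding F_def by (rule recession_cone_fibre)
  have zero: "0 \<in> recession_cone M \<inter> mat_ker A"
    by (simp add: recession_cone_def mat_ker_def)
  have unbounded: "\<exists>d. d \<noteq> 0 \<and> d \<in> recession_cone M \<inter> mat_ker A" if "\<not> compact X"
  proof -
    have "closed X" unfolding X using closed_convex by auto
    with that have "\<not> bounded X" by (simp add: compact_eq_bounded_closed)
    then obtain d where "d \<noteq> 0"
      "\<And>D. X \<subseteq> D \<Longrightarrow> closed D \<Longrightarrow> convex D \<Longrightarrow> d \<in> recession_cone D"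
      using unbounded_imp_common_recession_direction by blast
    then show ?thesis using closed_convex X recF by blast
  qed
  have bounded: "d = 0" if "compact X" and d: "d \<in> recession_cone M \<inter> mat_ker A" for d
  proof (rule bounded_imp_recession_direction_zero)
    show "bounded X" "xs \<in> X" using that assms by (auto intro: compact_imp_bounded)
    fix t :: real assume "t > 0"
    with d recF \<open>xs \<in> X\<close> show "xs + t *\<^sub>R d \<in> X"
      unfolding X recF[symmetric] recession_cone_def by auto
  qed
  have "compact X \<longleftrightarrow> recession_cone M \<inter> mat_ker A = {0}"
    using unbounded bounded zero by blast
  moreover have "compact X" if "recession_cone (orth_proj (mat_ker A) ` M) = {0}"
    using unbounded recession_cone_orth_proj_image[OF subspace_mat_ker] that by blast
  ultimately show ?thesis by (simp add: M_def)
qed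

end
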